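(* Let $(X,d)$ be a uniformly discrete metric space with bounded geometry. If $X$ is strongly embeddable, then $X$ is coarsely embeddable.
   Context: A metric space is uniformly discrete if distinct points are at distance at least some fixed $\delta>0$, and has bounded geometry if for every $r>0$ the cardinality of balls of radius $r$ is uniformly bounded. $B_S(x)=\{y : d(x,y)<S\}$ denotes the ball of radius $S$ centered at $x$. $(X,d)$ is strongly embeddable if for every $R,\epsilon>0$ there exists a map $\beta : X \to \ell^2(X)$, $x \mapsto \beta_x$, with $\|\beta_x\|=1$ for each $x\in X$, such that: (1) if $d(x,y)\le R$ then $\|\beta_x-\beta_y\|\le\epsilon$; (2) $\lim_{S\to\infty}\sup_{x\in X}\sum_{w\notin B_S(x)}|\beta_x(w)|^2=0$. $(X,d)$ is coarsely embeddable if there exist a Hilbert space $\mathcal{H}$, a map $\phi : X\to\mathcal{H}$ and nondecreasing maps $\rho_-,\rho_+ : [0,\infty)\to\mathbb{R}$ with $\lim_{r\to\infty}\rho_\pm(r)=\infty$ such that $\rho_-(d(x,y))\le\|\phi(x)-\phi(y)\|\le\rho_+(d(x,y))$ for all $x,y\in X$. *)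

theory Defs
  imports "HOL-Analysis.Analysis" "HOL-Algebra.Module"
begin

subsection \<open>Complex Hilbert spaces with an explicit carrier\<close>

text \<open>
  Coarse embeddability asks for the \<^emph>\<open>existence\<close> of a Hilbert space.  Since one cannot quantify
  over types inside a formula, Hilbert spaces are structures with an explicit carrier here, rather
  than types of class \<^class>\<open>real_inner\<close>.
\<close>

definition complex_ring :: "complex ring" where
  "complex_ring = \<lparr>carrier = UNIV, mult = (*), one = 1, zero = 0, add = (+)\<rparr>"

locale complex_inner_product_space = module complex_ring V
  for V :: "(complex, 'h) module" (structure) +
  fixes ip :: "'h \<Rightarrow> 'h \<Rightarrow> complex"
  assumes ip_add_left:
      "\<lbrakk>u \<in> carrier V; v \<in> carrier V; w \<in> carrier V\<rbrakk> \<Longrightarrow> ip (u \<oplus> v) w = ip u w + ip v w"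
    and ip_smult_left:
      "\<lbrakk>u \<in> carrier V; v \<in> carrier V\<rbrakk> \<Longrightarrow> ip (c \<odot> u) v = c * ip u v"
    and ip_cnj:
      "\<lbrakk>u \<in> carrier V; v \<in> carrier V\<rbrakk> \<Longrightarrow> ip v u = cnj (ip u v)"
    and ip_pos:
      "\<lbrakk>u \<in> carrier V; u \<noteq> \<zero>\<rbrakk> \<Longrightarrow> 0 < Re (ip u u)"
begin

definition hnorm :: "'h \<Rightarrow> real" where
  "hnorm u = sqrt (Re (ip u u))"

text \<open>
  The value \<open>0\<close> off the carrier is there because the locale \<^locale>\<open>Metric_space\<close> asks for
  symmetry and nonnegativity on the whole type.
\<close>

definition hdist :: "'h \<Rightarrow> 'h \<Rightarrow> real" where
  "hdist u v = (if u \<in> carrier V \<and> v \<in> carrier V then hnorm (u \<ominus> v) else 0)"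

end

locale complex_hilbert_space = complex_inner_product_space V ip
  for V :: "(complex, 'h) module" (structure) and ip +
  assumes complete: "Metric_space.mcomplete (carrier V) hdist"


subsection \<open>Square-summable functions\<close>

text \<open>Values of a function outside of \<open>X\<close> are irrelevant.\<close>

definition ell2 :: "'a set \<Rightarrow> ('a \<Rightarrow> complex) set" where
  "ell2 X = {f. (\<lambda>w. (cmod (f w))\<^sup>2) summable_on X}"

definition ell2_norm :: "'a set \<Rightarrow> ('a \<Rightarrow> complex) \<Rightarrow> real" where
  "ell2_norm X f = sqrt (\<Sum>\<^sub>\<infinity>w\<in>X. (cmod (f w))\<^sup>2)"


subsection \<open>Properties of metric spaces\<close>

context Metric_space
begin

definition uniformly_discrete :: bool where
  "uniformly_discrete \<longleftrightarrow> (\<exists>\<delta>>0. \<forall>x\<in>M. \<forall>y\<in>M. x \<noteq> y \<longrightarrow> \<delta> \<le> d x y)"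

definition bounded_geometry :: bool where
  "bounded_geometry \<longleftrightarrow>
     (\<forall>r>0. \<exists>N::nat. \<forall>x\<in>M. finite (mball x r) \<and> card (mball x r) \<le> N)"

text \<open>The supremum is taken in \<^typ>\<open>ennreal\<close>, where it is meaningful without side conditions.\<close>

definition strongly_embeddable :: bool where
  "strongly_embeddable \<longleftrightarrow>
     (\<forall>R>0. \<forall>\<epsilon>>0. \<exists>\<beta>.
        (\<forall>x\<in>M. \<beta> x \<in> ell2 M \<and> ell2_norm M (\<beta> x) = 1) \<and>
        (\<forall>x\<in>M. \<forall>y\<in>M. d x y \<le> R \<longrightarrow> ell2_norm M (\<lambda>w. \<beta> x w - \<beta> y w) \<le> \<epsilon>) \<and>
        ((\<lambda>S::real. SUP x\<in>M. ennreal (\<Sum>\<^sub>\<infinity>w\<in>M - mball x S. (cmod (\<beta> x w))\<^sup>2))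
           \<longlongrightarrow> 0) at_top)"

definition coarse_embedding ::
    "(complex, 'h) module \<Rightarrow> ('h \<Rightarrow> 'h \<Rightarrow> complex) \<Rightarrow> ('a \<Rightarrow> 'h) \<Rightarrow> bool" where
  "coarse_embedding V ip \<phi> \<longleftrightarrow>
     \<phi> \<in> M \<rightarrow> carrier V \<and>
     (\<exists>\<rho>\<^sub>1 \<rho>\<^sub>2 :: real \<Rightarrow> real.
        mono_on {0..} \<rho>\<^sub>1 \<and> mono_on {0..} \<rho>\<^sub>2 \<and>
        filterlim \<rho>\<^sub>1 at_top at_top \<and> filterlim \<rho>\<^sub>2 at_top at_top \<and>
        (\<forall>x\<in>M. \<forall>y\<in>M.
           \<rho>\<^sub>1 (d x y) \<le> complex_inner_product_space.hdist V ip (\<phi> x) (\<phi> y) \<and>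
           complex_inner_product_space.hdist V ip (\<phi> x) (\<phi> y) \<le> \<rho>\<^sub>2 (d x y)))"

definition coarsely_embeddable_in :: "'h itself \<Rightarrow> bool" where
  "coarsely_embeddable_in _ \<longleftrightarrow>
     (\<exists>(V :: (complex, 'h) module) ip \<phi>. complex_hilbert_space V ip \<and> coarse_embedding V ip \<phi>)"

text \<open>
  The Hilbert space ranges over all Hilbert spaces whose carrier is a set of functions of type
  \<^typ>\<open>'a \<times> nat \<Rightarrow> complex\<close>.  This is no restriction: by \<open>coarsely_embeddable_inI\<close> below, a coarse
  embedding into a Hilbert space over any type whatsoever yields one of this kind.
\<close>

definition coarsely_embeddable :: bool where
  "coarsely_embeddable \<longleftrightarrow> coarsely_embeddable_in TYPE('a \<times> nat \<Rightarrow> complex)"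

end

subsection \<open>Independence of the type carrying the Hilbert space\<close>

context complex_inner_product_space
begin

lemma complex_ring_simps [simp]:
  "carrier complex_ring = UNIV" "x \<oplus>\<^bsub>complex_ring\<^esub> y = x + y" "x \<otimes>\<^bsub>complex_ring\<^esub> y = x * y"
  "\<one>\<^bsub>complex_ring\<^esub> = 1" "\<zero>\<^bsub>complex_ring\<^esub> = 0"
  by (simp_all add: complex_ring_def)

lemma minus_eq_zero_iff:
  assumes "u \<in> carrier V" "v \<in> carrier V"
  shows "u \<ominus> v = \<zero> \<longleftrightarrow> u = v"
proof -
  have "(u \<ominus> v) \<oplus> v = u"
    using assms by (simp add: M.minus_eq M.a_assoc M.l_neg)
  then show ?thesis
    using assms by (metis M.l_zero M.minus_eq M.r_neg)
qed

lemma ip_zero_left: "v \<in> carrier V \<Longrightarrow> ip \<zero> v = 0"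
  using ip_add_left[of "\<zero>" "\<zero>" v] by simp

lemma ip_uminus_left: "u \<in> carrier V \<Longrightarrow> v \<in> carrier V \<Longrightarrow> ip (\<ominus> u) v = - ip u v"
  using ip_add_left[of "\<ominus> u" u v] ip_zero_left[of v]
  by (simp add: M.l_neg add_eq_0_iff2)

lemma ip_minus_left:
  "u \<in> carrier V \<Longrightarrow> v \<in> carrier V \<Longrightarrow> w \<in> carrier V \<Longrightarrow> ip (u \<ominus> v) w = ip u w - ip v w"
  by (simp add: M.minus_eq ip_add_left ip_uminus_left)

lemma ip_add_right:
  "u \<in> carrier V \<Longrightarrow> v \<in> carrier V \<Longrightarrow> w \<in> carrier V \<Longrightarrow> ip w (u \<oplus> v) = ip w u + ip w v"
  by (simp add: ip_cnj[of _ w] ip_add_left)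

lemma ip_minus_right:
  "u \<in> carrier V \<Longrightarrow> v \<in> carrier V \<Longrightarrow> w \<in> carrier V \<Longrightarrow> ip w (u \<ominus> v) = ip w u - ip w v"
  by (simp add: ip_cnj[of _ w] ip_minus_left)

lemma ip_smult_right:
  "u \<in> carrier V \<Longrightarrow> v \<in> carrier V \<Longrightarrow> ip u (c \<odot> v) = cnj c * ip u v"
  by (simp add: ip_cnj[of _ u] ip_smult_left)

lemma Re_ip_nonneg: "u \<in> carrier V \<Longrightarrow> 0 \<le> Re (ip u u)"
  using ip_pos[of u] ip_zero_left[of "\<zero>"] by (cases "u = \<zero>") auto

lemma ip_self_real: "u \<in> carrier V \<Longrightarrow> ip u u = of_real (Re (ip u u))"
  using ip_cnj[of u u] by (simp add: complex_eq_iff)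

lemma hnorm_nonneg: "u \<in> carrier V \<Longrightarrow> 0 \<le> hnorm u"
  by (simp add: hnorm_def Re_ip_nonneg)

lemma hnorm_square: "u \<in> carrier V \<Longrightarrow> (hnorm u)\<^sup>2 = Re (ip u u)"
  by (simp add: hnorm_def Re_ip_nonneg)

lemma hnorm_eq_0: "u \<in> carrier V \<Longrightarrow> hnorm u = 0 \<longleftrightarrow> u = \<zero>"
  using ip_pos[of u] ip_zero_left[of "\<zero>"] by (cases "u = \<zero>") (simp_all add: hnorm_def)

lemma Cauchy_Schwarz:
  assumes u: "u \<in> carrier V" and v: "v \<in> carrier V"
  shows "cmod (ip u v) \<le> hnorm u * hnorm v"
proof (cases "v = \<zero>")
  case True
  then show ?thesis
    using u v hnorm_eq_0[of v] ip_zero_left[of u] ip_cnj[of "\<zero>" u] by simp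
next
  case False
  define b where "b = Re (ip v v)"
  define a where "a = ip u v"
  have b: "b > 0" "ip v v = of_real b"
    using ip_pos[OF v False] ip_self_real[OF v] by (auto simp: b_def)
  have vu: "ip v u = cnj a" using ip_cnj[OF u v] by (simp add: a_def)
  let ?w = "of_real b \<odot> u \<ominus> a \<odot> v"
  have c: "of_real b \<odot> u \<in> carrier V" "a \<odot> v \<in> carrier V"
    using u v by auto
  have "ip ?w ?w = of_real b * (of_real b * ip u u - a * cnj a)"
    using u v c b vu
    by (simp add: ip_minus_left ip_minus_right ip_smult_left ip_smult_right a_def[symmetric]
        algebra_simps)
  also have "a * cnj a = of_real ((cmod a)\<^sup>2)"
    by (metis complex_norm_square)
  finally have "Re (ip ?w ?w) = b * (b * Re (ip u u) - (cmod a)\<^sup>2)"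
    by simp
  moreover have "0 \<le> Re (ip ?w ?w)"
    using c by (intro Re_ip_nonneg) auto
  ultimately have "(cmod a)\<^sup>2 \<le> Re (ip u u) * b"
    using b by (simp add: zero_le_mult_iff mult.commute)
  also have "\<dots> = (hnorm u * hnorm v)\<^sup>2"
    using u v by (simp add: power_mult_distrib hnorm_square b_def)
  finally show ?thesis
    unfolding a_def using hnorm_nonneg u v by (meson power2_le_imp_le mult_nonneg_nonneg)
qed

lemma hnorm_triangle:
  assumes u: "u \<in> carrier V" and v: "v \<in> carrier V"
  shows "hnorm (u \<oplus> v) \<le> hnorm u + hnorm v"
proof -
  have "(hnorm (u \<oplus> v))\<^sup>2 = Re (ip u u) + Re (ip v v) + Re (ip u v) + Re (ip v u)"
    using u v by (simp add: hnorm_square ip_add_left ip_add_right)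
  also have "Re (ip v u) = Re (ip u v)"
    using ip_cnj[OF u v] by simp
  also have "Re (ip u v) \<le> hnorm u * hnorm v"
    using Cauchy_Schwarz[OF u v] complex_Re_le_cmod order_trans by blast
  finally have "(hnorm (u \<oplus> v))\<^sup>2 \<le> (hnorm u + hnorm v)\<^sup>2"
    using u v by (simp add: power2_sum hnorm_square)
  then show ?thesis
    using hnorm_nonneg u v by (meson power2_le_imp_le add_nonneg_nonneg)
qed

lemma hdist_eq: "u \<in> carrier V \<Longrightarrow> v \<in> carrier V \<Longrightarrow> hdist u v = hnorm (u \<ominus> v)"
  by (simp add: hdist_def)

lemma Metric_space_hdist: "Metric_space (carrier V) hdist"
proof
  fix u v
  show "0 \<le> hdist u v"
    by (simp add: hdist_def hnorm_nonneg)
  show "hdist u v = hdist v u"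
    by (simp add: hdist_def hnorm_def ip_minus_left ip_minus_right)
next
  fix u v assume "u \<in> carrier V" "v \<in> carrier V"
  then show "hdist u v = 0 \<longleftrightarrow> u = v"
    by (simp add: hdist_eq hnorm_eq_0 minus_eq_zero_iff)
next
  fix u v w assume uvw: "u \<in> carrier V" "v \<in> carrier V" "w \<in> carrier V"
  then have "u \<ominus> w = (u \<ominus> v) \<oplus> (v \<ominus> w)"
    by (simp add: M.minus_eq M.a_assoc M.r_neg1 M.l_neg)
  with uvw hnorm_triangle[of "u \<ominus> v" "v \<ominus> w"] show "hdist u w \<le> hdist u v + hdist v w"
    by (simp add: hdist_eq)
qed

end

text \<open>
  The closed linear span of the image of \<open>\<phi>\<close>, described as its double orthogonal complement, embeds
  into a function space through \<open>k \<mapsto> (x \<mapsto> \<langle>k, \<phi> x\<rangle>)\<close>; the Hilbert space structure is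
  transported along this injection.
\<close>

lemma (in complex_hilbert_space) transport_span:
  fixes \<phi> :: "'a \<Rightarrow> 'h" and X :: "'a set"
  assumes \<phi>: "\<phi> \<in> X \<rightarrow> carrier V"
  obtains W :: "(complex, 'a \<times> nat \<Rightarrow> complex) module" and ip' \<psi>
  where "complex_hilbert_space W ip'" "\<psi> \<in> X \<rightarrow> carrier W"
    "\<And>x y. x \<in> X \<Longrightarrow> y \<in> X \<Longrightarrow>
       complex_inner_product_space.hdist W ip' (\<psi> x) (\<psi> y) = hdist (\<phi> x) (\<phi> y)"
proof -
  have \<phi>c: "\<phi> x \<in> carrier V" if "x \<in> X" for x
    using \<phi> that by auto
  define K where "K = {k \<in> carrier V. \<forall>h\<in>carrier V. (\<forall>x\<in>X. ip h (\<phi> x) = 0) \<longrightarrow> ip k h = 0}"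
  define T :: "'h \<Rightarrow> 'a \<times> nat \<Rightarrow> complex"
    where "T = (\<lambda>k p. if fst p \<in> X then ip k (\<phi> (fst p)) else 0)"
  define S where "S = inv_into K T"
  define W :: "(complex, 'a \<times> nat \<Rightarrow> complex) module"
    where "W = \<lparr>carrier = T ` K, mult = (\<lambda>f g. f), one = (\<lambda>p. 0), zero = (\<lambda>p. 0),
      add = (\<lambda>f g p. f p + g p), smult = (\<lambda>c f p. c * f p)\<rparr>"
  define ip' where "ip' = (\<lambda>f g. ip (S f) (S g))"
  have W_simps [simp]: "carrier W = T ` K" "\<zero>\<^bsub>W\<^esub> = (\<lambda>p. 0)"
    "\<And>f g. f \<oplus>\<^bsub>W\<^esub> g = (\<lambda>p. f p + g p)" "\<And>c f. c \<odot>\<^bsub>W\<^esub> f = (\<lambda>p. c * f p)"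
    by (simp_all add: W_def)
  have KV: "k \<in> carrier V" if "k \<in> K" for k
    using that by (simp add: K_def)
  have K_zero: "\<zero> \<in> K"
    by (simp add: K_def ip_zero_left)
  have K_add: "u \<oplus> v \<in> K" if "u \<in> K" "v \<in> K" for u v
    using that by (simp add: K_def ip_add_left)
  have K_smult: "c \<odot> u \<in> K" if "u \<in> K" for u c
    using that by (simp add: K_def ip_smult_left)
  have K_uminus: "\<ominus> u \<in> K" if "u \<in> K" for u
    using that by (simp add: K_def ip_uminus_left)
  have K_minus: "u \<ominus> v \<in> K" if "u \<in> K" "v \<in> K" for u v
    using that by (simp add: K_def ip_minus_left)
  have T_zero: "T \<zero> = (\<lambda>p. 0)"
    by (auto simp: T_def ip_zero_left \<phi>c)
  have T_add: "T (u \<oplus> v) = (\<lambda>p. T u p + T v p)" if "u \<in> K" "v \<in> K" for u v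
    using that by (auto simp: T_def ip_add_left \<phi>c KV)
  have T_smult: "T (c \<odot> u) = (\<lambda>p. c * T u p)" if "u \<in> K" for u c
    using that by (auto simp: T_def ip_smult_left \<phi>c KV)
  have T_uminus: "T (\<ominus> u) = (\<lambda>p. - T u p)" if "u \<in> K" for u
    using that by (auto simp: T_def ip_uminus_left \<phi>c KV)
  have T_minus: "T (u \<ominus> v) = (\<lambda>p. T u p - T v p)" if "u \<in> K" "v \<in> K" for u v
    using that by (auto simp: T_def ip_minus_left \<phi>c KV)
  have ker: "k = \<zero>" if k: "k \<in> K" "T k = (\<lambda>p. 0)" for k
  proof -
    have "ip k (\<phi> x) = 0" if "x \<in> X" for x
      using fun_cong[OF k(2), of "(x, 0)"] that by (simp add: T_def)
    then have "ip k k = 0"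
      using k(1) by (simp add: K_def)
    then show ?thesis
      using ip_pos[of k] KV[OF k(1)] by force
  qed
  have inj: "inj_on T K"
  proof (rule inj_onI)
    fix u v assume uv: "u \<in> K" "v \<in> K" "T u = T v"
    then have "u \<ominus> v = \<zero>"
      using ker[of "u \<ominus> v"] K_minus T_minus by simp
    then show "u = v"
      using uv KV minus_eq_zero_iff by blast
  qed
  have ST [simp]: "S (T u) = u" if "u \<in> K" for u
    using that inj by (simp add: S_def)
  have ab: "abelian_group W"
  proof (rule abelian_groupI)
    fix f assume "f \<in> carrier W"
    then obtain u where "u \<in> K" "f = T u" by auto
    then show "\<exists>g\<in>carrier W. g \<oplus>\<^bsub>W\<^esub> f = \<zero>\<^bsub>W\<^esub>"
      using K_uminus by (intro bexI[of _ "T (\<ominus> u)"]) (simp add: T_uminus, simp)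
  next
    show "f \<oplus>\<^bsub>W\<^esub> g \<in> carrier W" if "f \<in> carrier W" "g \<in> carrier W" for f g
      using that by (auto simp: T_add[symmetric] K_add)
    show "\<zero>\<^bsub>W\<^esub> \<in> carrier W"
      using K_zero by (auto simp: T_zero[symmetric])
  qed (auto simp: add_ac)
  interpret W: abelian_group W by (rule ab)
  have W_uminus: "\<ominus>\<^bsub>W\<^esub> T u = T (\<ominus> u)" if "u \<in> K" for u
    using that K_uminus[OF that] by (intro W.minus_equality) (simp add: T_uminus, simp_all)
  have W_minus: "T u \<ominus>\<^bsub>W\<^esub> T v = T (u \<ominus> v)" if "u \<in> K" "v \<in> K" for u v
    using that K_uminus by (simp add: W.minus_eq W_uminus M.minus_eq T_add)
  have mod: "module complex_ring W"
  proof (rule moduleI)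
    show "cring complex_ring"
      by (rule R.is_cring)
    show "c \<odot>\<^bsub>W\<^esub> f \<in> carrier W" if "f \<in> carrier W" for c f
      using that by (auto simp: T_smult[symmetric] K_smult)
  qed (use ab in \<open>auto simp: algebra_simps\<close>)
  interpret W: complex_inner_product_space W ip'
  proof (intro complex_inner_product_space.intro mod complex_inner_product_space_axioms.intro)
    show "ip' (f \<oplus>\<^bsub>W\<^esub> g) h = ip' f h + ip' g h"
      if "f \<in> carrier W" "g \<in> carrier W" "h \<in> carrier W" for f g h
      using that by (auto simp: ip'_def T_add[symmetric] K_add KV ip_add_left)
    show "ip' (c \<odot>\<^bsub>W\<^esub> f) g = c * ip' f g"
      if "f \<in> carrier W" "g \<in> carrier W" for c f g
      using that by (auto simp: ip'_def T_smult[symmetric] K_smult KV ip_smult_left)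
    show "ip' g f = cnj (ip' f g)" if "f \<in> carrier W" "g \<in> carrier W" for f g
      using that by (auto simp: ip'_def KV intro: ip_cnj)
    show "0 < Re (ip' f f)" if "f \<in> carrier W" "f \<noteq> \<zero>\<^bsub>W\<^esub>" for f
      using that by (auto simp: ip'_def KV T_zero intro!: ip_pos)
  qed
  have ip'_T: "ip' (T u) (T v) = ip u v" if "u \<in> K" "v \<in> K" for u v
    using that by (simp add: ip'_def)
  have W_hdist: "W.hdist (T u) (T v) = hdist u v" if "u \<in> K" "v \<in> K" for u v
    using that by (simp add: W.hdist_def hdist_def W.hnorm_def hnorm_def KV W_minus ip'_T K_minus)
  interpret mV: Metric_space "carrier V" hdist by (rule Metric_space_hdist)
  interpret mW: Metric_space "T ` K" W.hdist
    using W.Metric_space_hdist by simp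
  have "mW.mcomplete"
    unfolding mW.mcomplete_def
  proof (intro allI impI)
    fix \<sigma> assume \<sigma>: "mW.MCauchy \<sigma>"
    then have "\<forall>n. \<exists>u. u \<in> K \<and> \<sigma> n = T u"
      unfolding mW.MCauchy_def by blast
    then obtain \<tau> where \<tau>: "\<And>n. \<tau> n \<in> K" "\<And>n. \<sigma> n = T (\<tau> n)"
      by metis
    then have "mV.MCauchy \<tau>"
      using \<sigma> by (auto simp: mW.MCauchy_def mV.MCauchy_def W_hdist KV)
    then obtain u where "limitin mV.mtopology \<tau> u sequentially"
      using complete by (auto simp: mV.mcomplete_def)
    then have u: "u \<in> carrier V" "(\<lambda>n. hdist (\<tau> n) u) \<longlonglongrightarrow> 0"
      by (auto simp: mV.limitin_metric_dist_null)
    have "u \<in> K"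
      unfolding K_def
    proof (intro CollectI conjI ballI impI u)
      fix h assume h: "h \<in> carrier V" "\<forall>x\<in>X. ip h (\<phi> x) = 0"
      have "cmod (ip u h) \<le> hdist (\<tau> n) u * hnorm h" for n
      proof -
        have "ip (\<tau> n) h = 0"
          using \<tau>(1)[of n] h by (simp add: K_def)
        then have "cmod (ip u h) = cmod (ip (\<tau> n \<ominus> u) h)"
          using u h \<tau> KV by (simp add: ip_minus_left)
        also have "\<dots> \<le> hnorm (\<tau> n \<ominus> u) * hnorm h"
          using u h \<tau> KV by (intro Cauchy_Schwarz) auto
        finally show ?thesis
          using u \<tau> KV by (simp add: hdist_eq)
      qed
      moreover have "(\<lambda>n. hdist (\<tau> n) u * hnorm h) \<longlonglongrightarrow> 0"
        using tendsto_mult_right[OF u(2), of "hnorm h"] by simp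
      ultimately have "cmod (ip u h) \<le> 0"
        by (intro LIMSEQ_le_const) auto
      then show "ip u h = 0" by simp
    qed
    then have "limitin mW.mtopology \<sigma> (T u) sequentially"
      using u(2) \<tau> by (auto simp: mW.limitin_metric_dist_null W_hdist)
    then show "\<exists>f. limitin mW.mtopology \<sigma> f sequentially"
      by blast
  qed
  then have hilbert: "complex_hilbert_space W ip'"
    by (intro complex_hilbert_space.intro complex_hilbert_space_axioms.intro
        W.complex_inner_product_space_axioms) simp
  have \<phi>K: "\<phi> x \<in> K" if "x \<in> X" for x
    unfolding K_def
  proof (intro CollectI conjI ballI impI)
    fix h assume h: "h \<in> carrier V" "\<forall>x\<in>X. ip h (\<phi> x) = 0"
    then have "ip (\<phi> x) h = cnj (ip h (\<phi> x))"
      using \<phi>c[OF that] by (intro ip_cnj)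
    also have "\<dots> = 0"
      using h(2) that by simp
    finally show "ip (\<phi> x) h = 0" .
  qed (rule \<phi>c[OF that])
  show thesis
    by (rule that[OF hilbert, of "\<lambda>x. T (\<phi> x)"]) (auto simp: \<phi>K W_hdist)
qed

lemma (in Metric_space) coarsely_embeddable_inI:
  assumes "coarsely_embeddable_in TYPE('h)"
  shows "coarsely_embeddable"
proof -
  obtain V :: "(complex, 'h) module" and ip \<phi>
    where hilb: "complex_hilbert_space V ip" and ce: "coarse_embedding V ip \<phi>"
    using assms by (auto simp: coarsely_embeddable_in_def)
  interpret complex_hilbert_space V ip by (rule hilb)
  have "\<phi> \<in> M \<rightarrow> carrier V"
    using ce by (simp add: coarse_embedding_def)
  then obtain W :: "(complex, 'a \<times> nat \<Rightarrow> complex) module" and ip' \<psi>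
    where "complex_hilbert_space W ip'" and "\<psi> \<in> M \<rightarrow> carrier W"
      and "\<And>x y. x \<in> M \<Longrightarrow> y \<in> M \<Longrightarrow>
         complex_inner_product_space.hdist W ip' (\<psi> x) (\<psi> y) = hdist (\<phi> x) (\<phi> y)"
    by (rule transport_span) blast
  note W = this
  have "coarse_embedding W ip' \<psi>"
    using ce W(2) unfolding coarse_embedding_def by (simp add: W(3))
  with W(1) show ?thesis
    unfolding coarsely_embeddable_def coarsely_embeddable_in_def by blast
qed

end

theory Submission
  imports Defs
begin

text \<open>
  Choose unit vectors \<open>\<beta> n x\<close> from strong embeddability with \<open>R = n + 1\<close> and \<open>\<epsilon> = (1/2) ^ n\<close>.
  The map \<open>x \<mapsto> (\<lambda>(n, w). \<beta> n x w - \<beta> n x0 w)\<close> into the square-summable functions on \<open>\<nat> \<times> X\<close> is a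
  coarse embedding: the squared distance of the images of \<open>x\<close> and \<open>y\<close> is the sum over \<open>n\<close> of
  the squared norms of \<open>\<beta> n x - \<beta> n y\<close>.  All but \<open>\<lceil>d x y\<rceil>\<close> of these terms are dominated by a
  geometric series, and the others are at most \<open>4\<close>.  On the other hand, for each \<open>n\<close> the term is
  at least \<open>1/4\<close> as soon as \<open>d x y\<close> is large, because the two vectors are then concentrated on
  disjoint balls.
\<close>

section \<open>The Hilbert space of square-summable functions\<close>

lemma cmod_add_square_le: "(cmod (a + b))\<^sup>2 \<le> 2 * (cmod a)\<^sup>2 + 2 * (cmod b)\<^sup>2"
proof -
  have "(cmod (a + b))\<^sup>2 \<le> (cmod a + cmod b)\<^sup>2"
    by (intro power_mono norm_triangle_ineq) auto
  also have "\<dots> \<le> 2 * (cmod a)\<^sup>2 + 2 * (cmod b)\<^sup>2"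
    using sum_squares_bound[of "cmod a" "cmod b"] by (simp add: power2_sum)
  finally show ?thesis .
qed

lemma ell2_summable: "f \<in> ell2 X \<Longrightarrow> (\<lambda>w. (cmod (f w))\<^sup>2) summable_on X"
  by (simp add: ell2_def)

lemma ell2_norm_square: "(ell2_norm X f)\<^sup>2 = (\<Sum>\<^sub>\<infinity>w\<in>X. (cmod (f w))\<^sup>2)"
  by (simp add: ell2_norm_def infsum_nonneg)

lemma ell2_norm_nonneg: "0 \<le> ell2_norm X f"
  by (simp add: ell2_norm_def infsum_nonneg)

lemma ell2_smult:
  assumes "f \<in> ell2 X"
  shows "(\<lambda>w. c * f w) \<in> ell2 X"
  using summable_on_cmult_right[OF ell2_summable[OF assms], of "(cmod c)\<^sup>2"]
  by (simp add: ell2_def norm_mult power_mult_distrib)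

lemma ell2_add:
  assumes "f \<in> ell2 X" "g \<in> ell2 X"
  shows "(\<lambda>w. f w + g w) \<in> ell2 X"
proof -
  have "(\<lambda>w. 2 * (cmod (f w))\<^sup>2 + 2 * (cmod (g w))\<^sup>2) summable_on X"
    using assms by (intro summable_on_add summable_on_cmult_right ell2_summable)
  then show ?thesis
    unfolding ell2_def
    by (auto intro: summable_on_comparison_test cmod_add_square_le)
qed

lemma ell2_diff:
  assumes "f \<in> ell2 X" "g \<in> ell2 X"
  shows "(\<lambda>w. f w - g w) \<in> ell2 X"
  using ell2_add[OF assms(1) ell2_smult[OF assms(2), of "-1"]] by simp

text \<open>Summing the pointwise bound keeps everything in squares, so no triangle inequality for
  the norm is needed. It serves both the upper bound for unit vectors and the separation
  estimate.\<close>

lemma ell2_norm_diff_square_le: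
  assumes "f \<in> ell2 X" "g \<in> ell2 X"
  shows "(ell2_norm X (\<lambda>w. f w - g w))\<^sup>2 \<le> 2 * (ell2_norm X f)\<^sup>2 + 2 * (ell2_norm X g)\<^sup>2"
proof -
  note s = assms[THEN ell2_summable, THEN summable_on_cmult_right[where c = "2::real"]]
  have "(ell2_norm X (\<lambda>w. f w - g w))\<^sup>2 \<le> (\<Sum>\<^sub>\<infinity>w\<in>X. 2 * (cmod (f w))\<^sup>2 + 2 * (cmod (g w))\<^sup>2)"
    unfolding ell2_norm_square
    using cmod_add_square_le[of "f w" "- g w" for w] ell2_summable[OF ell2_diff[OF assms]] s
    by (intro infsum_mono summable_on_add) auto
  also have "\<dots> = 2 * (ell2_norm X f)\<^sup>2 + 2 * (ell2_norm X g)\<^sup>2"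
    using s by (simp add: infsum_add infsum_cmult_right' ell2_norm_square)
  finally show ?thesis .
qed

text \<open>Absolute convergence, since \<open>2 * s * t \<le> s^2 + t^2\<close> for the two
  moduli.\<close>

lemma ell2_mult_cnj_summable:
  assumes "f \<in> ell2 X" "g \<in> ell2 X"
  shows "(\<lambda>w. f w * cnj (g w)) summable_on X"
proof -
  have "(\<lambda>w. (cmod (f w))\<^sup>2 + (cmod (g w))\<^sup>2) summable_on X"
    using assms by (intro summable_on_add ell2_summable)
  then have "(\<lambda>w. norm (f w * cnj (g w))) summable_on X"
  proof (rule summable_on_comparison_test)
    fix w
    have "0 \<le> cmod (f w) * cmod (g w)" by simp
    then show "norm (f w * cnj (g w)) \<le> (cmod (f w))\<^sup>2 + (cmod (g w))\<^sup>2"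
      using sum_squares_bound[of "cmod (f w)" "cmod (g w)"]
      unfolding norm_mult complex_mod_cnj by linarith
  qed auto
  then show ?thesis
    by (rule abs_summable_summable)
qed

section \<open>Inner product space structure\<close>

text \<open>\<open>mult\<close> and \<open>one\<close> are fillers required by the record type; a
  module uses only the additive group and the scalars. Functions on a subset of the index type enter
  by extension with zero.\<close>

definition ell2_space :: "(complex, 'i \<Rightarrow> complex) module" where
  "ell2_space = \<lparr>carrier = ell2 UNIV, mult = (\<lambda>f g. f), one = (\<lambda>i. 0), zero = (\<lambda>i. 0),
     add = (\<lambda>f g i. f i + g i), smult = (\<lambda>c f i. c * f i)\<rparr>"

definition ell2_ip :: "('i \<Rightarrow> complex) \<Rightarrow> ('i \<Rightarrow> complex) \<Rightarrow> complex" where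
  "ell2_ip f g = (\<Sum>\<^sub>\<infinity>i. f i * cnj (g i))"

lemma ell2_space_simps [simp]:
  "carrier ell2_space = ell2 UNIV" "\<zero>\<^bsub>ell2_space\<^esub> = (\<lambda>i. 0)"
  "f \<oplus>\<^bsub>ell2_space\<^esub> g = (\<lambda>i. f i + g i)" "c \<odot>\<^bsub>ell2_space\<^esub> f = (\<lambda>i. c * f i)"
  by (simp_all add: ell2_space_def)

lemma cring_complex_ring: "cring complex_ring"
proof (rule cringI)
  show "abelian_group complex_ring"
  proof (rule abelian_groupI)
    show "\<exists>y\<in>carrier complex_ring. y \<oplus>\<^bsub>complex_ring\<^esub> x = \<zero>\<^bsub>complex_ring\<^esub>" for x
      by (intro bexI[of _ "- x"]) (simp_all add: complex_ring_def)
  qed (simp_all add: complex_ring_def)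
  show "comm_monoid complex_ring"
    by (rule comm_monoidI) (simp_all add: complex_ring_def)
qed (simp add: complex_ring_def algebra_simps)

lemma abelian_group_ell2_space: "abelian_group ell2_space"
proof (rule abelian_groupI)
  show "\<exists>g\<in>carrier ell2_space. g \<oplus>\<^bsub>ell2_space\<^esub> f = \<zero>\<^bsub>ell2_space\<^esub>"
    if "f \<in> carrier ell2_space" for f :: "'i \<Rightarrow> complex"
    using that ell2_smult[of f UNIV "-1"] by (intro bexI[of _ "\<lambda>i. - f i"]) auto
qed (auto simp: ell2_add add_ac, simp add: ell2_def)

lemma ell2_ip_self:
  assumes "f \<in> ell2 UNIV"
  shows "ell2_ip f f = of_real ((ell2_norm UNIV f)\<^sup>2)"
proof -
  have "ell2_ip f f = (\<Sum>\<^sub>\<infinity>i. of_real ((cmod (f i))\<^sup>2))"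
    unfolding ell2_ip_def by (intro infsum_cong) (metis complex_norm_square)
  also have "\<dots> = of_real ((ell2_norm UNIV f)\<^sup>2)"
    unfolding ell2_norm_square
    by (intro infsumI has_sum_of_real has_sum_infsum ell2_summable assms)
  finally show ?thesis .
qed

lemma ell2_norm_sum_le:
  assumes "f \<in> ell2 X" "finite F" "F \<subseteq> X"
  shows "(\<Sum>w\<in>F. (cmod (f w))\<^sup>2) \<le> (ell2_norm X f)\<^sup>2"
  unfolding ell2_norm_square using assms
  by (intro finite_sum_le_infsum ell2_summable) auto

lemma cmod_le_ell2_norm:
  assumes "f \<in> ell2 X" "w \<in> X"
  shows "cmod (f w) \<le> ell2_norm X f"
  using ell2_norm_sum_le[OF assms(1), of "{w}"] assms(2) ell2_norm_nonneg[of X f]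
  by (auto intro: power2_le_imp_le)

text \<open>Nonnegative sums are suprema of finite partial sums. This form suits pointwise limits,
  under which only finite sums pass to the limit directly.\<close>

lemma ell2_norm_leI:
  assumes "\<And>F. finite F \<Longrightarrow> F \<subseteq> X \<Longrightarrow> (\<Sum>w\<in>F. (cmod (f w))\<^sup>2) \<le> c\<^sup>2" and "0 \<le> c"
  shows "f \<in> ell2 X" "ell2_norm X f \<le> c"
proof -
  have s: "(\<lambda>w. (cmod (f w))\<^sup>2) summable_on X"
    by (rule nonneg_bdd_above_summable_on) (auto intro!: bdd_aboveI[of _ "c\<^sup>2"] assms)
  then show "f \<in> ell2 X"
    by (simp add: ell2_def)
  have "(ell2_norm X f)\<^sup>2 \<le> c\<^sup>2"
    unfolding ell2_norm_square by (rule infsum_le_finite_sums[OF s]) (rule assms)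
  then show "ell2_norm X f \<le> c"
    using assms(2) by (rule power2_le_imp_le)
qed

interpretation ell2_space: complex_inner_product_space ell2_space ell2_ip
proof (intro complex_inner_product_space.intro complex_inner_product_space_axioms.intro)
  show "module complex_ring (ell2_space :: (complex, 'i \<Rightarrow> complex) module)"
    by (rule moduleI[OF cring_complex_ring abelian_group_ell2_space])
      (auto simp: ell2_smult complex_ring_def algebra_simps)
next
  fix f g h :: "'i \<Rightarrow> complex" and c
  assume f: "f \<in> carrier ell2_space" and g: "g \<in> carrier ell2_space"
  show "ell2_ip (c \<odot>\<^bsub>ell2_space\<^esub> f) g = c * ell2_ip f g"
    by (simp add: ell2_ip_def infsum_cmult_right' mult.assoc)
  show "ell2_ip g f = cnj (ell2_ip f g)"
    by (simp add: ell2_ip_def infsum_cnj[symmetric] mult.commute)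
  show "ell2_ip (f \<oplus>\<^bsub>ell2_space\<^esub> g) h = ell2_ip f h + ell2_ip g h"
    if "h \<in> carrier ell2_space"
    using f g that by (simp add: ell2_ip_def distrib_right infsum_add ell2_mult_cnj_summable)
next
  fix f :: "'i \<Rightarrow> complex"
  assume f: "f \<in> carrier ell2_space" "f \<noteq> \<zero>\<^bsub>ell2_space\<^esub>"
  then obtain i where "f i \<noteq> 0" by auto
  then have "0 < ell2_norm UNIV f"
    using cmod_le_ell2_norm[of f UNIV i] f(1) by (simp add: less_le_trans[of 0 "cmod (f i)"])
  then show "0 < Re (ell2_ip f f)"
    using f(1) by (simp add: ell2_ip_self)
qed

lemma ell2_space_minus:
  assumes "f \<in> ell2 UNIV" "g \<in> ell2 UNIV"
  shows "f \<ominus>\<^bsub>ell2_space\<^esub> g = (\<lambda>i. f i - g i)"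
proof -
  have "\<ominus>\<^bsub>ell2_space\<^esub> g = (\<lambda>i. - g i)"
    using assms(2) ell2_smult[of g UNIV "-1"]
    by (intro ell2_space.M.minus_equality) auto
  then show ?thesis
    by (simp add: ell2_space.M.minus_eq)
qed

lemma ell2_space_hdist:
  assumes "f \<in> ell2 UNIV" "g \<in> ell2 UNIV"
  shows "ell2_space.hdist f g = ell2_norm UNIV (\<lambda>i. f i - g i)"
  using assms
  by (simp add: ell2_space.hdist_eq ell2_space.hnorm_def ell2_space_minus ell2_ip_self
      ell2_diff ell2_norm_nonneg)

section \<open>Completeness\<close>

theorem complex_hilbert_space_ell2:
  "complex_hilbert_space (ell2_space :: (complex, 'i \<Rightarrow> complex) module) ell2_ip"
proof -
  interpret m: Metric_space "ell2 UNIV :: ('i \<Rightarrow> complex) set" ell2_space.hdist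
    using ell2_space.Metric_space_hdist by simp
  have "m.mcomplete"
    unfolding m.mcomplete_def
  proof (intro allI impI)
    fix \<sigma> :: "nat \<Rightarrow> 'i \<Rightarrow> complex"
    assume \<sigma>: "m.MCauchy \<sigma>"
    then have in_ell2: "\<sigma> n \<in> ell2 UNIV" for n
      by (auto simp: m.MCauchy_def)
    have cauchy: "\<exists>N. \<forall>n\<ge>N. \<forall>k\<ge>N. ell2_norm UNIV (\<lambda>i. \<sigma> n i - \<sigma> k i) < e" if "e > 0" for e
      using \<sigma> that by (simp add: m.MCauchy_def ell2_space_hdist in_ell2)
    \<comment> \<open>Evaluation at \<open>i\<close> does not increase the norm, so every coordinate
      sequence is Cauchy.\<close>
    have "convergent (\<lambda>n. \<sigma> n i)" for i
    proof -
      have "Cauchy (\<lambda>n. \<sigma> n i)"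
      proof (rule CauchyI)
        fix e :: real assume "e > 0"
        then obtain N where "\<forall>n\<ge>N. \<forall>k\<ge>N. ell2_norm UNIV (\<lambda>i. \<sigma> n i - \<sigma> k i) < e"
          using cauchy by blast
        then show "\<exists>N. \<forall>n\<ge>N. \<forall>k\<ge>N. norm (\<sigma> n i - \<sigma> k i) < e"
          using cmod_le_ell2_norm[OF ell2_diff[OF in_ell2 in_ell2] UNIV_I] le_less_trans by blast
      qed
      then show ?thesis
        by (rule Cauchy_convergent)
    qed
    then obtain g where g: "\<And>i. (\<lambda>n. \<sigma> n i) \<longlonglongrightarrow> g i"
      unfolding convergent_def by metis
    have lim: "\<exists>N. \<forall>n\<ge>N. (\<lambda>i. \<sigma> n i - g i) \<in> ell2 UNIV \<and>
        ell2_norm UNIV (\<lambda>i. \<sigma> n i - g i) \<le> e" if e: "e > 0" for e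
    proof -
      obtain N where N: "\<And>n k. n \<ge> N \<Longrightarrow> k \<ge> N \<Longrightarrow> ell2_norm UNIV (\<lambda>i. \<sigma> n i - \<sigma> k i) < e"
        using cauchy[OF e] by blast
      \<comment> \<open>Fatou-type argument: for fixed finite \<open>F\<close>, let \<open>k\<close>
        tend to infinity in the Cauchy estimate; the bound does not depend on
        \<open>F\<close>.\<close>
      have "(\<Sum>i\<in>F. (cmod (\<sigma> n i - g i))\<^sup>2) \<le> e\<^sup>2" if n: "n \<ge> N" and F: "finite F" for n F
      proof (rule LIMSEQ_le_const2)
        show "(\<lambda>k. \<Sum>i\<in>F. (cmod (\<sigma> n i - \<sigma> k i))\<^sup>2) \<longlonglongrightarrow> (\<Sum>i\<in>F. (cmod (\<sigma> n i - g i))\<^sup>2)"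
          by (intro tendsto_intros g)
        have "(\<Sum>i\<in>F. (cmod (\<sigma> n i - \<sigma> k i))\<^sup>2) \<le> e\<^sup>2" if "k \<ge> N" for k
        proof -
          have "(\<Sum>i\<in>F. (cmod (\<sigma> n i - \<sigma> k i))\<^sup>2) \<le> (ell2_norm UNIV (\<lambda>i. \<sigma> n i - \<sigma> k i))\<^sup>2"
            by (intro ell2_norm_sum_le ell2_diff in_ell2 F) auto
          also have "\<dots> \<le> e\<^sup>2"
            using N[OF n that] by (intro power_mono ell2_norm_nonneg) auto
          finally show ?thesis .
        qed
        then show "\<exists>N. \<forall>k\<ge>N. (\<Sum>i\<in>F. (cmod (\<sigma> n i - \<sigma> k i))\<^sup>2) \<le> e\<^sup>2"
          by blast
      qed
      then show ?thesis
        using e by (intro exI[of _ N] allI impI conjI ell2_norm_leI) auto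
    qed
    \<comment> \<open>One such index suffices, as \<open>g\<close> is \<open>\<sigma> N\<close>
      minus this difference.\<close>
    obtain N where "(\<lambda>i. \<sigma> N i - g i) \<in> ell2 UNIV"
      using lim[OF zero_less_one] by blast
    then have g_ell2: "g \<in> ell2 UNIV"
      using ell2_diff[OF in_ell2[of N]] by fastforce
    have "(\<lambda>n. ell2_space.hdist (\<sigma> n) g) \<longlonglongrightarrow> 0"
    proof (rule LIMSEQ_I)
      fix e :: real assume "e > 0"
      then obtain N where "\<forall>n\<ge>N. ell2_norm UNIV (\<lambda>i. \<sigma> n i - g i) \<le> e / 2"
        using lim[of "e / 2"] by auto
      then show "\<exists>N. \<forall>n\<ge>N. norm (ell2_space.hdist (\<sigma> n) g - 0) < e"
        using \<open>e > 0\<close>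
        by (intro exI[of _ N]) (force simp: ell2_space_hdist in_ell2 g_ell2 ell2_norm_nonneg)
    qed
    then have "limitin m.mtopology \<sigma> g sequentially"
      by (simp add: m.limitin_metric_dist_null g_ell2 in_ell2)
    then show "\<exists>f. limitin m.mtopology \<sigma> f sequentially"
      by blast
  qed
  then show ?thesis
    by (intro complex_hilbert_space.intro complex_hilbert_space_axioms.intro
        ell2_space.complex_inner_product_space_axioms) simp
qed

section \<open>The coarse embedding\<close>

text \<open>On \<open>A\<close>, \<open>f\<close> has squared mass at least 7/8 and \<open>g\<close>
  at most 1/8. Writing \<open>f\<close> as the difference plus \<open>g\<close> gives 7/8 \<le> 2 t
  + 2/8 for the squared norm t of the difference, hence t \<ge> 5/16.\<close>

lemma ell2_norm_diff_separated:
  assumes f: "f \<in> ell2 X" and g: "g \<in> ell2 X" and norm: "ell2_norm X f = 1"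
    and A: "A \<subseteq> X" "A \<inter> B = {}"
    and tail_f: "(\<Sum>\<^sub>\<infinity>w\<in>X - A. (cmod (f w))\<^sup>2) \<le> 1/8"
    and tail_g: "(\<Sum>\<^sub>\<infinity>w\<in>X - B. (cmod (g w))\<^sup>2) \<le> 1/8"
  shows "1/4 \<le> (ell2_norm X (\<lambda>w. f w - g w))\<^sup>2"
proof -
  let ?h = "\<lambda>w. f w - g w"
  have h: "?h \<in> ell2 X"
    using f g by (rule ell2_diff)
  have sub: "u \<in> ell2 Y" if "u \<in> ell2 X" "Y \<subseteq> X" for u Y
    using that unfolding ell2_def by (auto intro: summable_on_subset_banach)
  have "1 = (\<Sum>\<^sub>\<infinity>w\<in>A. (cmod (f w))\<^sup>2) + (\<Sum>\<^sub>\<infinity>w\<in>X - A. (cmod (f w))\<^sup>2)"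
  proof -
    have "1 = (\<Sum>\<^sub>\<infinity>w\<in>A \<union> (X - A). (cmod (f w))\<^sup>2)"
      using ell2_norm_square[of X f] norm A(1) by (simp add: Un_absorb1)
    also have "\<dots> = (\<Sum>\<^sub>\<infinity>w\<in>A. (cmod (f w))\<^sup>2) + (\<Sum>\<^sub>\<infinity>w\<in>X - A. (cmod (f w))\<^sup>2)"
      using A(1) by (intro infsum_Un_disjoint ell2_summable sub[OF f]) auto
    finally show ?thesis .
  qed
  with tail_f have "7/8 \<le> (ell2_norm A f)\<^sup>2"
    by (simp add: ell2_norm_square)
  also have "\<dots> = (ell2_norm A (\<lambda>w. ?h w - - g w))\<^sup>2"
    by simp
  also have "\<dots> \<le> 2 * (ell2_norm A ?h)\<^sup>2 + 2 * (ell2_norm A (\<lambda>w. - g w))\<^sup>2"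
    using sub[OF h A(1)] ell2_smult[OF sub[OF g A(1)], of "-1"]
    by (intro ell2_norm_diff_square_le) auto
  \<comment> \<open>Disjointness puts \<open>A\<close> inside \<open>X - B\<close>, so the mass of
    \<open>g\<close> on \<open>A\<close> is part of its tail.\<close>
  also have "(ell2_norm A (\<lambda>w. - g w))\<^sup>2 \<le> (\<Sum>\<^sub>\<infinity>w\<in>X - B. (cmod (g w))\<^sup>2)"
    unfolding ell2_norm_square norm_minus_cancel
    using A by (intro infsum_mono_neutral ell2_summable sub[OF g]) auto
  also have "(ell2_norm A ?h)\<^sup>2 \<le> (ell2_norm X ?h)\<^sup>2"
    unfolding ell2_norm_square
    using A by (intro infsum_mono_neutral ell2_summable sub[OF h]) auto
  finally show ?thesis
    using tail_g by linarith
qed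

text \<open>The last clause keeps the only consequence of the tail decay that the lower bound uses;
  \<open>S\<close> is a distance threshold, not the radius of a ball.\<close>

definition (in Metric_space) separating_unit_vectors ::
    "real \<Rightarrow> real \<Rightarrow> ('a \<Rightarrow> 'a \<Rightarrow> complex) \<Rightarrow> real \<Rightarrow> bool" where
  "separating_unit_vectors R \<epsilon> \<beta> S \<longleftrightarrow>
     (\<forall>x\<in>M. \<beta> x \<in> ell2 M \<and> ell2_norm M (\<beta> x) = 1) \<and>
     (\<forall>x\<in>M. \<forall>y\<in>M. d x y \<le> R \<longrightarrow> ell2_norm M (\<lambda>w. \<beta> x w - \<beta> y w) \<le> \<epsilon>) \<and>
     (\<forall>x\<in>M. \<forall>y\<in>M. S \<le> d x y \<longrightarrow> 1/4 \<le> (ell2_norm M (\<lambda>w. \<beta> x w - \<beta> y w))\<^sup>2)"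

lemma (in Metric_space) strongly_embeddable_imp_separating_unit_vectors:
  assumes "strongly_embeddable" "R > 0" "\<epsilon> > 0"
  shows "\<exists>\<beta> S. separating_unit_vectors R \<epsilon> \<beta> S"
proof -
  obtain \<beta> where \<beta>: "\<forall>x\<in>M. \<beta> x \<in> ell2 M \<and> ell2_norm M (\<beta> x) = 1"
    "\<forall>x\<in>M. \<forall>y\<in>M. d x y \<le> R \<longrightarrow> ell2_norm M (\<lambda>w. \<beta> x w - \<beta> y w) \<le> \<epsilon>"
    and lim: "((\<lambda>S::real. SUP x\<in>M. ennreal (\<Sum>\<^sub>\<infinity>w\<in>M - mball x S. (cmod (\<beta> x w))\<^sup>2)) \<longlongrightarrow> 0) at_top"
    using assms(1)[unfolded strongly_embeddable_def, rule_format, OF assms(2,3)]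
    by (elim exE conjE) (rule that)
  \<comment> \<open>The value 1/8 is the tail bound demanded by
    \<open>ell2_norm_diff_separated\<close>.\<close>
  have "\<forall>\<^sub>F S::real in at_top.
      (SUP x\<in>M. ennreal (\<Sum>\<^sub>\<infinity>w\<in>M - mball x S. (cmod (\<beta> x w))\<^sup>2)) < ennreal (1/8)"
    by (rule order_tendstoD(2)[OF lim]) simp
  then obtain S :: real where
    S: "(SUP x\<in>M. ennreal (\<Sum>\<^sub>\<infinity>w\<in>M - mball x S. (cmod (\<beta> x w))\<^sup>2)) < ennreal (1/8)"
    using eventually_happens'[OF trivial_limit_at_top_linorder] by blast
  have tail: "(\<Sum>\<^sub>\<infinity>w\<in>M - mball x S. (cmod (\<beta> x w))\<^sup>2) \<le> 1/8" if "x \<in> M" for x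
  proof -
    have "ennreal (\<Sum>\<^sub>\<infinity>w\<in>M - mball x S. (cmod (\<beta> x w))\<^sup>2) \<le> ennreal (1/8)"
      using that S by (intro SUP_lessD[THEN less_imp_le])
    then show ?thesis
      by (subst (asm) ennreal_le_iff) auto
  qed
  \<comment> \<open>Balls are open, so distance at least \<open>2 * S\<close> already makes the
    balls of radius \<open>S\<close> disjoint.\<close>
  have "1/4 \<le> (ell2_norm M (\<lambda>w. \<beta> x w - \<beta> y w))\<^sup>2" if "x \<in> M" "y \<in> M" "2 * S \<le> d x y" for x y
  proof (rule ell2_norm_diff_separated[OF _ _ _ _ _ tail tail])
    show "mball x S \<inter> mball y S = {}"
    proof -
      have False if w: "w \<in> mball x S" "w \<in> mball y S" for w
        using w triangle[of x w y] commute[of w y] \<open>2 * S \<le> d x y\<close> by auto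
      then show ?thesis by blast
    qed
  qed (use that \<beta>(1) in auto)
  with \<beta> have "separating_unit_vectors R \<epsilon> \<beta> (2 * S)"
    by (simp add: separating_unit_vectors_def)
  then show ?thesis
    by blast
qed

section \<open>Combining all scales into one embedding\<close>

lemma (in Metric_space) strongly_imp_coarsely_embeddable:
  assumes "strongly_embeddable"
  shows "coarsely_embeddable"
proof -
  \<comment> \<open>The added 1 makes the radius positive at \<open>n = 0\<close>.\<close>
  have "\<exists>\<beta> S. separating_unit_vectors (real n + 1) ((1/2) ^ n) \<beta> S" for n :: nat
    by (intro strongly_embeddable_imp_separating_unit_vectors[OF assms]) auto
  then obtain \<beta> S where \<beta>: "\<And>n. separating_unit_vectors (real n + 1) ((1/2) ^ n) (\<beta> n) (S n)"
    by metis
  have \<beta>_ell2: "\<beta> n x \<in> ell2 M" and \<beta>_norm: "ell2_norm M (\<beta> n x) = 1" if "x \<in> M" for n x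
    using \<beta>[of n] that by (auto simp: separating_unit_vectors_def)
  have \<beta>_close: "ell2_norm M (\<lambda>w. \<beta> n x w - \<beta> n y w) \<le> (1/2) ^ n"
    if "x \<in> M" "y \<in> M" "d x y \<le> real n + 1" for n x y
    using \<beta>[of n] that by (auto simp: separating_unit_vectors_def)
  have \<beta>_far: "1/4 \<le> (ell2_norm M (\<lambda>w. \<beta> n x w - \<beta> n y w))\<^sup>2"
    if "x \<in> M" "y \<in> M" "S n \<le> d x y" for n x y
    using \<beta>[of n] that by (auto simp: separating_unit_vectors_def)
  define a where "a x y n = (ell2_norm M (\<lambda>w. \<beta> n x w - \<beta> n y w))\<^sup>2" for x y n
  \<comment> \<open>From the index \<open>N r\<close> on, \<open>r \<le> n\<close>, so the closeness
    estimate applies to points at distance \<open>r\<close>.\<close>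
  define N where "N r = nat \<lceil>r\<rceil>" for r :: real
  have a_nonneg: "0 \<le> a x y n" for x y n
    by (simp add: a_def)
  \<comment> \<open>The majorant of \<open>a x y\<close> with \<open>k = N (d x y)\<close>:
    \<open>k\<close> terms 4 plus a geometric series of sum 2.\<close>
  have bound_has_sum:
    "((\<lambda>n. (if n < k then 4 else 0) + (1/2) ^ n) has_sum (4 * real k + 2)) UNIV" for k :: nat
  proof (rule sums_nonneg_imp_has_sum)
    have "(\<lambda>n. if n \<in> {..<k} then 4 else 0) sums (\<Sum>n<k. 4 :: real)"
      by (rule sums_If_finite_set) simp
    from sums_add[OF this geometric_sums[of "1/2 :: real"]]
    show "(\<lambda>n. (if n < k then 4 else 0) + (1/2) ^ n) sums (4 * real k + 2)"
      by (simp add: mult.commute)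
  qed auto
  have a_le: "a x y n \<le> (if n < N (d x y) then 4 else 0) + (1/2) ^ n"
    if xy: "x \<in> M" "y \<in> M" for x y n
  proof (cases "n < N (d x y)")
    case True
    \<comment> \<open>Here 4 = 2 * 1 + 2 * 1, both vectors having norm 1.\<close>
    have "a x y n \<le> 4"
      using ell2_norm_diff_square_le[OF \<beta>_ell2[OF xy(1)] \<beta>_ell2[OF xy(2)], of n n]
      by (simp add: a_def \<beta>_norm xy)
    then show ?thesis
      using True by (simp add: add_increasing2)
  next
    case False
    then have "d x y \<le> real n + 1"
      unfolding N_def by linarith
    then have "a x y n \<le> ((1/2) ^ n)\<^sup>2"
      unfolding a_def by (intro power_mono \<beta>_close xy ell2_norm_nonneg)
    \<comment> \<open>Dropping the square is affordable and leaves the geometric series with ratio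
      1/2.\<close>
    also have "\<dots> \<le> (1/2) ^ n"
      by (simp add: power2_eq_square mult_le_cancel_left1 power_le_one)
    finally show ?thesis
      using False by simp
  qed
  have a_summable: "a x y summable_on UNIV" if "x \<in> M" "y \<in> M" for x y
    using has_sum_imp_summable[OF bound_has_sum] a_le[OF that] a_nonneg
    by (rule summable_on_comparison_test)
  \<comment> \<open>Tonelli for nonnegative terms: the double sum is evaluated slice by slice in
    \<open>n\<close>.\<close>
  have slices: "((\<lambda>(n, w). (cmod (\<beta> n x w - \<beta> n y w))\<^sup>2) has_sum infsum (a x y) UNIV)
      (UNIV \<times> M)" if "x \<in> M" "y \<in> M" for x y
  proof (rule has_sum_SigmaI)
    show "((\<lambda>w. case (n, w) of (n, w) \<Rightarrow> (cmod (\<beta> n x w - \<beta> n y w))\<^sup>2) has_sum a x y n) M" for n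
      using ell2_summable[OF ell2_diff[OF \<beta>_ell2[OF that(1)] \<beta>_ell2[OF that(2)]], of n n]
      by (simp add: a_def ell2_norm_square)
    then show "(\<lambda>(n, w). (cmod (\<beta> n x w - \<beta> n y w))\<^sup>2) summable_on (UNIV \<times> M)"
      using a_summable[OF that] by (intro summable_on_SigmaI) auto
    show "(a x y has_sum infsum (a x y) UNIV) UNIV"
      using a_summable[OF that] by simp
  qed
  \<comment> \<open>The unit vectors \<open>\<beta> n x\<close> over all \<open>n\<close> are not
    jointly square-summable; differences from a base point are, and the base point cancels in
    \<open>\<phi> x - \<phi> y\<close>. If \<open>M\<close> is empty the choice is arbitrary, but
    \<open>x0\<close> is then never evaluated in a claim.\<close>
  define x0 where "x0 = (SOME x. x \<in> M)"
  define \<phi> :: "'a \<Rightarrow> nat \<times> 'a \<Rightarrow> complex"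
    where "\<phi> x = (\<lambda>(n, w). if w \<in> M then \<beta> n x w - \<beta> n x0 w else 0)" for x
  have x0: "x0 \<in> M" if "x \<in> M" for x
    using that unfolding x0_def by (rule someI)
  have \<phi>_ell2: "\<phi> x \<in> ell2 UNIV" if "x \<in> M" for x
  proof -
    have "(\<lambda>(n, w). (cmod (\<beta> n x w - \<beta> n x0 w))\<^sup>2) summable_on (UNIV \<times> M)"
      using slices[OF that x0[OF that]] by (rule has_sum_imp_summable)
    then show ?thesis
      unfolding ell2_def mem_Collect_eq
      by (rule summable_on_cong_neutral[THEN iffD1, rotated -1]) (auto simp: \<phi>_def split: if_splits)
  qed
  have dist: "ell2_space.hdist (\<phi> x) (\<phi> y) = sqrt (infsum (a x y) UNIV)"
    if "x \<in> M" "y \<in> M" for x y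
  proof -
    have "((\<lambda>p. (cmod (\<phi> x p - \<phi> y p))\<^sup>2) has_sum infsum (a x y) UNIV) UNIV"
      using slices[OF that]
      by (rule has_sum_cong_neutral[THEN iffD1, rotated -1]) (auto simp: \<phi>_def split: if_splits)
    then show ?thesis
      using that by (simp add: ell2_space_hdist \<phi>_ell2 ell2_norm_def infsumI)
  qed
  \<comment> \<open>The scales known to separate points at distance \<open>r\<close>. The condition
    \<open>real n \<le> r\<close> makes the set finite; an infinite set would have
    \<open>card\<close> equal to 0 and spoil monotonicity.\<close>
  define I where "I r = {n. S n \<le> r \<and> real n \<le> r}" for r
  \<comment> \<open>Each scale in \<open>I r\<close> contributes at least 1/4 to the squared
    distance.\<close>
  define \<rho>\<^sub>1 where "\<rho>\<^sub>1 r = sqrt (real (card (I r)) / 4)" for r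
  define \<rho>\<^sub>2 where "\<rho>\<^sub>2 r = sqrt (4 * real (N r) + 2)" for r
  have I_finite: "finite (I r)" for r
  proof (rule finite_subset)
    show "I r \<subseteq> {..nat \<lfloor>r\<rfloor>}"
      unfolding I_def by (auto simp: le_nat_floor)
  qed simp
  have "coarse_embedding ell2_space ell2_ip \<phi>"
    unfolding coarse_embedding_def
  proof (intro conjI exI ballI)
    show "\<phi> \<in> M \<rightarrow> carrier ell2_space"
      using \<phi>_ell2 by auto
    show "mono_on {0..} \<rho>\<^sub>1"
    proof (rule mono_onI)
      fix r s :: real assume "r \<le> s"
      then have "I r \<subseteq> I s"
        by (auto simp: I_def)
      then show "\<rho>\<^sub>1 r \<le> \<rho>\<^sub>1 s"
        unfolding \<rho>\<^sub>1_def by (simp add: card_mono I_finite)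
    qed
    show "mono_on {0..} \<rho>\<^sub>2"
      by (intro mono_onI) (simp add: \<rho>\<^sub>2_def N_def ceiling_mono nat_mono)
    have "filterlim (\<lambda>r. card (I r)) at_top at_top"
      unfolding filterlim_at_top
    proof
      fix k :: nat
      \<comment> \<open>Only finitely many thresholds must be passed before the first
        \<open>k\<close> scales all lie in \<open>I r\<close>.\<close>
      have "\<forall>\<^sub>F r in at_top. \<forall>n\<in>{..<k}. S n \<le> r \<and> real n \<le> r"
        by (intro eventually_ball_finite ballI eventually_conj eventually_ge_at_top) simp
      then show "\<forall>\<^sub>F r in at_top. k \<le> card (I r)"
      proof eventually_elim
        case (elim r)
        then have "{..<k} \<subseteq> I r"
          by (auto simp: I_def)
        from card_mono[OF I_finite this] show ?case by simp
      qed
    qed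
    then have "filterlim (\<lambda>r. real (card (I r)) * (1/4)) at_top at_top"
      by (intro filterlim_at_top_mult_tendsto_pos[OF tendsto_const]
          filterlim_compose[OF filterlim_real_sequentially]) auto
    then show "filterlim \<rho>\<^sub>1 at_top at_top"
      unfolding \<rho>\<^sub>1_def by (intro filterlim_compose[OF sqrt_at_top]) simp
    \<comment> \<open>The function dominates the identity, because
      \<open>r \<le> real (N r)\<close>.\<close>
    have "filterlim (\<lambda>r. 4 * real (N r) + 2) at_top at_top"
      by (rule filterlim_at_top_mono[OF filterlim_ident])
        (auto intro!: always_eventually simp: N_def, linarith)
    then show "filterlim \<rho>\<^sub>2 at_top at_top"
      unfolding \<rho>\<^sub>2_def by (rule filterlim_compose[OF sqrt_at_top])
  next
    fix x y assume xy: "x \<in> M" "y \<in> M"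
    have "real (card (I (d x y))) / 4 = (\<Sum>n\<in>I (d x y). 1/4)"
      by simp
    also have "\<dots> \<le> (\<Sum>n\<in>I (d x y). a x y n)"
      unfolding a_def by (intro sum_mono \<beta>_far xy) (auto simp: I_def)
    also have "\<dots> \<le> infsum (a x y) UNIV"
      using a_nonneg by (intro finite_sum_le_infsum a_summable xy I_finite) auto
    finally show "\<rho>\<^sub>1 (d x y) \<le> ell2_space.hdist (\<phi> x) (\<phi> y)"
      by (simp add: dist xy \<rho>\<^sub>1_def)
    have "infsum (a x y) UNIV \<le> 4 * real (N (d x y)) + 2"
      using has_sum_infsum[OF a_summable[OF xy]] bound_has_sum a_le[OF xy]
      by (rule has_sum_mono)
    then show "ell2_space.hdist (\<phi> x) (\<phi> y) \<le> \<rho>\<^sub>2 (d x y)"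
      by (simp add: dist xy \<rho>\<^sub>2_def)
  qed
  \<comment> \<open>The index type is \<open>nat \<times> 'a\<close>, not the
    \<open>'a \<times> nat\<close> of \<open>coarsely_embeddable\<close>; the transport lemma
    \<open>coarsely_embeddable_inI\<close> bridges this.\<close>
  then have "coarsely_embeddable_in TYPE(nat \<times> 'a \<Rightarrow> complex)"
    unfolding coarsely_embeddable_in_def using complex_hilbert_space_ell2 by blast
  then show ?thesis
    by (rule coarsely_embeddable_inI)
qed

theorem lemma4p3:
  fixes X :: "'a set" and d :: "'a \<Rightarrow> 'a \<Rightarrow> real"
  assumes "Metric_space X d"
    and "Metric_space.uniformly_discrete X d"
    and "Metric_space.bounded_geometry X d"
    and "Metric_space.strongly_embeddable X d"
  shows "Metric_space.coarsely_embeddable X d"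
  using assms(1,4) by (rule Metric_space.strongly_imp_coarsely_embeddable)

end
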